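(* Let $H$ be an invertible Hermitian matrix and let $B_0$ be a nilpotent $H$-nonnegative matrix in Jordan form which has a Segre pairing $\mathcal{S}$. Then any pair of $\mathcal{S}$ is of the form $(2,2)$, $(2,1)$, $(1,1)$ or $(1,0)$. These pairs correspond to Jordan blocks of the form $J_2(0)\oplus J_2(0)$, $J_2(0)\oplus J_1(0)$, $J_1(0)\oplus J_1(0)$ and $J_1(0)$, respectively, in the matrix $B_0$. The square roots for each possible pair are as follows (in each item, the square roots of the given matrix are exactly the matrices listed). (i) Pair $(1,0)$: the square root of $J_1(0)=[0]$ is $[0]$, with Jordan form $J_1(0)$. (ii) Pair $(1,1)$: the square roots of $J_1(0)\oplus J_1(0)$ are $$\begin{bmatrix}\alpha & \frac{-\alpha^2}{\beta}\\ \beta & -\alpha\end{bmatrix}\ \text{ for any } \alpha,\beta\in\mathbb{C} \text{ with } \beta\ne 0,\qquad\text{or}\qquad \begin{bmatrix}0&\alpha\\0&0\end{bmatrix}\ \text{ for any }\alpha\in\mathbb{C}.$$ The Jordan form of all these matrices is $J_2(0)$, except for the second type with $\alpha=0$, where the Jordan form is $J_1(0)\oplus J_1(0)$. (iii) Pair $(2,1)$: the square roots of $J_2(0)\oplus J_1(0)$ are $$\begin{bmatrix}0&\alpha&\beta\\0&0&0\\0&\frac1\beta&0\end{bmatrix}\ \text{ for } \alpha,\beta\in\mathbb{C},\ \beta\neq 0.$$ The Jordan form of all these matrices is $J_3(0)$. (iv) Pair $(2,2)$: the square roots of $J_2(0)\oplus J_2(0)$ are $$\begin{bmatrix}-\alpha_3&-\alpha_4&\frac{-\alpha_3^2}{\alpha_1}&\beta\\0&-\alpha_3&0&\frac{-\alpha_3^2}{\alpha_1}\\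 \alpha_1&\alpha_2&\alpha_3&\alpha_4\\0&\alpha_1&0&\alpha_3\end{bmatrix}$$ for $\alpha_1,\alpha_2,\alpha_3,\alpha_4\in\mathbb{C}$ with $\alpha_1\neq0$ and $\beta=\frac{1}{\alpha_1^2}\left(\alpha_1+\alpha_3^2\alpha_2-2\alpha_1\alpha_3\alpha_4\right)$, or $$\begin{bmatrix}0&\gamma_1&\gamma_2&\gamma_3\\0&0&0&\gamma_2\\0&\frac1{\gamma_2}&0&-\gamma_1\\0&0&0&0\end{bmatrix}$$ for $\gamma_1,\gamma_2,\gamma_3\in\mathbb{C}$ with $\gamma_2\ne0$. The Jordan form of all these matrices is $J_4(0)$.
   Context: With $(\cdot,\cdot)$ the Euclidean inner product on $\mathbb{C}^n$ and $[x,y]=(Hx,y)$, a matrix $B\in\mathbb{C}^{n\times n}$ is $H$-nonnegative if $[Bx,x]\ge 0$ for all $x\in\mathbb{C}^n$. A square root of a complex square matrix $B$ is a complex matrix $A$ of the same size with $A^2=B$. $J_k(\lambda)$ denotes the $k\times k$ (upper triangular) Jordan block with eigenvalue $\lambda$. The Segre characteristic of a nilpotent matrix $B_0$ is the list $(n_1,\ldots,n_r)$ of the sizes of its Jordan blocks, in decreasing order. A Segre pairing of $B_0$ is a finite collection (with repetitions allowed, arranged lexicographically) of pairs of numbers from $\{n_1,\ldots,n_r\}\cup\{0\}$ such that: each entry $n_i$ of the Segre characteristic (entries counted with multiplicity) appears in one and only one pair; each pair consists either of two entries of the Segre characteristic or of one entry of the Segre characteristic and one zero, with first entry greater than or equal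 to the second; and the absolute difference between the two entries of each pair is at most one. *)

theory Defs
  imports
    "HOL-Library.Multiset"
    "Jordan_Normal_Form.Schur_Decomposition"
    "Jordan_Normal_Form.Jordan_Normal_Form_Uniqueness"
begin

definition hermitian_mat :: "complex mat \<Rightarrow> bool" where
  "hermitian_mat H \<longleftrightarrow> square_mat H \<and> mat_adjoint H = H"

definition indef_inner :: "complex mat \<Rightarrow> complex vec \<Rightarrow> complex vec \<Rightarrow> complex" where
  "indef_inner H x y = (H *\<^sub>v x) \<bullet>c y"

(* The order on complex numbers is the one of Complex_Order: 0 \<le> z says that z is real and
   nonnegative. *)
definition H_nonnegative :: "complex mat \<Rightarrow> complex mat \<Rightarrow> bool" where
  "H_nonnegative H B \<longleftrightarrow>
     (\<forall>x \<in> carrier_vec (dim_row H). 0 \<le> indef_inner H (B *\<^sub>v x) x)"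

definition nilpotent_mat :: "complex mat \<Rightarrow> bool" where
  "nilpotent_mat B \<longleftrightarrow>
     square_mat B \<and> (\<exists>k. B ^\<^sub>m k = 0\<^sub>m (dim_row B) (dim_row B))"

definition square_root :: "complex mat \<Rightarrow> complex mat \<Rightarrow> bool" where
  "square_root A B \<longleftrightarrow> A \<in> carrier_mat (dim_row B) (dim_row B) \<and> A * A = B"

(* jordan_nf already requires all block sizes to be nonzero. *)
definition segre_characteristic :: "complex mat \<Rightarrow> nat list \<Rightarrow> bool" where
  "segre_characteristic B ns \<longleftrightarrow>
     sorted_wrt (\<ge>) ns \<and> jordan_nf B (map (\<lambda>k. (k, 0)) ns)"

(* A finite collection with repetitions is a multiset; its lexicographic arrangement is only the
   canonical listing of that multiset. The multiset equation says that the entries of the Segre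
   characteristic, counted with multiplicity, are distributed over the pairs without omission
   or repetition; the zeros only fill up pairs. *)
definition segre_pairing :: "complex mat \<Rightarrow> (nat \<times> nat) multiset \<Rightarrow> bool" where
  "segre_pairing B S \<longleftrightarrow>
     (\<exists>ns. segre_characteristic B ns \<and>
        filter_mset (\<lambda>k. k \<noteq> 0) (\<Sum>p\<in>#S. {#fst p, snd p#}) = mset ns \<and>
        (\<forall>(a, b) \<in> set_mset S.
           a \<in> set ns \<and> (b \<in> set ns \<or> b = 0) \<and> b \<le> a \<and> a \<le> b + 1))"

abbreviation J :: "nat \<Rightarrow> complex mat" where
  "J k \<equiv> jordan_block k 0"

(* The nilpotent Jordan blocks belonging to a pair; a zero entry contributes no block. *)
definition pair_blocks :: "nat \<times> nat \<Rightarrow> complex mat list" where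
  "pair_blocks p = map J (filter (\<lambda>k. k \<noteq> 0) [fst p, snd p])"

definition root11a :: "complex \<Rightarrow> complex \<Rightarrow> complex mat" where
  "root11a \<alpha> \<beta> = mat_of_rows_list 2
     [[\<alpha>, - \<alpha>\<^sup>2 / \<beta>],
      [\<beta>, - \<alpha>]]"

definition root11b :: "complex \<Rightarrow> complex mat" where
  "root11b \<alpha> = mat_of_rows_list 2
     [[0, \<alpha>],
      [0, 0]]"

definition root21 :: "complex \<Rightarrow> complex \<Rightarrow> complex mat" where
  "root21 \<alpha> \<beta> = mat_of_rows_list 3
     [[0, \<alpha>, \<beta>],
      [0, 0, 0],
      [0, 1 / \<beta>, 0]]"

definition root22a :: "complex \<Rightarrow> complex \<Rightarrow> complex \<Rightarrow> complex \<Rightarrow> complex mat" where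
  "root22a \<alpha>1 \<alpha>2 \<alpha>3 \<alpha>4 =
     (let \<beta> = 1 / \<alpha>1\<^sup>2 * (\<alpha>1 + \<alpha>3\<^sup>2 * \<alpha>2 - 2 * \<alpha>1 * \<alpha>3 * \<alpha>4)
      in mat_of_rows_list 4
        [[- \<alpha>3, - \<alpha>4, - \<alpha>3\<^sup>2 / \<alpha>1, \<beta>],
         [0, - \<alpha>3, 0, - \<alpha>3\<^sup>2 / \<alpha>1],
         [\<alpha>1, \<alpha>2, \<alpha>3, \<alpha>4],
         [0, \<alpha>1, 0, \<alpha>3]])"

definition root22b :: "complex \<Rightarrow> complex \<Rightarrow> complex \<Rightarrow> complex mat" where
  "root22b \<gamma>1 \<gamma>2 \<gamma>3 = mat_of_rows_list 4
     [[0, \<gamma>1, \<gamma>2, \<gamma>3],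
      [0, 0, 0, \<gamma>2],
      [0, 1 / \<gamma>2, 0, - \<gamma>1],
      [0, 0, 0, 0]]"

end

theory Submission
  imports Defs "Jordan_Normal_Form.Jordan_Normal_Form_Existence"
begin

text \<open>
  The restriction on the pairs comes from the identity \<open>B0\<^sup>2 = 0\<close>. The form \<open>[B0 u, u]\<close> is nonnegative,
  so Cauchy--Schwarz applies to it: a vector on which it vanishes lies in the kernel of \<open>H B0\<close>, that
  is, of \<open>B0\<close>. If \<open>B0\<^sup>3 x = 0\<close>, then \<open>B0 x\<close> is such a vector, because \<open>B0\<close> is selfadjoint for
  \<open>[\<cdot>,\<cdot>]\<close>; so \<open>B0\<^sup>2 x = 0\<close>. Thus the kernels of
  \<open>B0\<^sup>2\<close> and \<open>B0\<^sup>3\<close> coincide, and nilpotency makes this common kernel the whole space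
  (\<open>H_nonnegative_nilpotent_square_zero\<close>). Blocks therefore have size at most 2
  (\<open>jordan_nf_pow_eq_zero_iff\<close>), and a pair has a positive first entry and a second entry that is equal
  to it or one less. The blocks of \<open>B0\<close> are those named by the pairs since the Jordan normal form is
  unique as a multiset (\<open>jordan_nf_mset_unique\<close>).

  A square root \<open>A\<close> of \<open>B\<close> commutes with \<open>B\<close>. For \<open>J 2 \<oplus> J 1\<close> and \<open>J 2 \<oplus> J 2\<close> these linear conditions
  leave so few unknown entries that \<open>A\<^sup>2 = B\<close> can be solved by hand. For \<open>J 2 \<oplus> J 2\<close>, write \<open>N = J 2\<close>;
  the commuting matrices are \<open>X \<otimes> 1 + Y \<otimes> N\<close> with 2 by 2 matrices \<open>X\<close> and \<open>Y\<close>, and the condition becomes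
  \<open>X\<^sup>2 = 0\<close> and \<open>X Y + Y X = 1\<close> (\<open>block_toeplitz_square\<close>). The two families arise according to whether
  the lower left entry of \<open>X\<close> is nonzero or zero.

  Every root other than the zero matrix of size 2 is nilpotent of the largest index that its size
  permits, and such a matrix is similar to a single Jordan block (\<open>jordan_nf_single_block\<close>).
\<close>

section \<open>Jordan normal forms of nilpotent matrices\<close>

lemma four_block_diag_eq_zero_iff:
  fixes A D :: "'a :: zero mat"
  shows "four_block_mat A (0\<^sub>m (dim_row A) (dim_col D)) (0\<^sub>m (dim_row D) (dim_col A)) D
           = 0\<^sub>m (dim_row A + dim_row D) (dim_col A + dim_col D)
         \<longleftrightarrow> A = 0\<^sub>m (dim_row A) (dim_col A) \<and> D = 0\<^sub>m (dim_row D) (dim_col D)"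
    (is "?F = ?Z \<longleftrightarrow> ?A \<and> ?D")
proof
  assume F: "?F = ?Z"
  have "A $$ (i,j) = 0" if "i < dim_row A" "j < dim_col A" for i j
    using arg_cong[OF F, of "\<lambda>M. M $$ (i,j)"] that by simp
  moreover have "D $$ (i,j) = 0" if "i < dim_row D" "j < dim_col D" for i j
    using arg_cong[OF F, of "\<lambda>M. M $$ (dim_row A + i, dim_col A + j)"] that by simp
  ultimately show "?A \<and> ?D" by (auto intro!: eq_matI)
next
  assume "?A \<and> ?D"
  then have "A $$ (i,j) = 0" if "i < dim_row A" "j < dim_col A" for i j
    using that by (metis index_zero_mat(1))
  moreover have "D $$ (i,j) = 0" if "i < dim_row D" "j < dim_col D" for i j
    using that \<open>?A \<and> ?D\<close> by (metis index_zero_mat(1))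
  ultimately show "?F = ?Z" by (auto intro!: eq_matI)
qed

lemma diag_block_mat_eq_zero_iff:
  fixes As :: "'a :: zero mat list"
  shows "diag_block_mat As = 0\<^sub>m (dim_row (diag_block_mat As)) (dim_col (diag_block_mat As))
         \<longleftrightarrow> (\<forall>A \<in> set As. A = 0\<^sub>m (dim_row A) (dim_col A))"
  by (induction As) (auto simp: Let_def four_block_diag_eq_zero_iff)

lemma jordan_block_pow_eq_zero_iff:
  fixes a :: "'a :: field"
  assumes "k \<noteq> 0"
  shows "jordan_block k a ^\<^sub>m m = 0\<^sub>m k k \<longleftrightarrow> a = 0 \<and> k \<le> m"
proof
  assume Z: "jordan_block k a ^\<^sub>m m = 0\<^sub>m k k"
  from assms have "(jordan_block k a ^\<^sub>m m) $$ (0,0) = a ^ m"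
    by (simp add: jordan_block_pow)
  with Z assms have a: "a = 0" by simp
  have "k \<le> m"
  proof (rule ccontr)
    assume "\<not> k \<le> m"
    then have "(jordan_block k a ^\<^sub>m m) $$ (0,m) = 1"
      by (simp add: a jordan_block_zero_pow)
    with Z \<open>\<not> k \<le> m\<close> show False by simp
  qed
  with a show "a = 0 \<and> k \<le> m" by simp
next
  assume "a = 0 \<and> k \<le> m"
  then show "jordan_block k a ^\<^sub>m m = 0\<^sub>m k k"
    by (auto simp: jordan_block_zero_pow intro!: eq_matI)
qed

lemma similar_mat_pow_eq_zero_iff:
  assumes "similar_mat A B" and "A \<in> carrier_mat n n"
  shows "A ^\<^sub>m m = 0\<^sub>m n n \<longleftrightarrow> B ^\<^sub>m m = 0\<^sub>m n n"
proof -
  from assms(1) obtain P Q where wit: "similar_mat_wit A B P Q"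
    unfolding similar_mat_def by auto
  note w = similar_mat_witD2[OF assms(2) wit]
  show ?thesis
    using similar_mat_wit_pow_id[OF wit, of m]
      similar_mat_wit_pow_id[OF similar_mat_wit_sym[OF wit], of m] w(6,7) by auto
qed

text \<open>Similarity preserves the vanishing of a power, and powers of a block diagonal matrix are taken
  block by block, so nilpotency of a given order is a condition on each block separately. It is used
  to bound block sizes from above and, with two consecutive exponents, to recognise a single block.\<close>
lemma jordan_nf_pow_eq_zero_iff:
  fixes A :: "'a :: field mat"
  assumes A: "A \<in> carrier_mat n n" and nf: "jordan_nf A n_as"
  shows "A ^\<^sub>m m = 0\<^sub>m n n \<longleftrightarrow> (\<forall>(k, a) \<in> set n_as. a = 0 \<and> k \<le> m)"
proof -
  let ?D = "diag_block_mat (map (\<lambda>(k, a). jordan_block k a ^\<^sub>m m) n_as)"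
  from nf have sim: "similar_mat A (jordan_matrix n_as)" and pos: "0 \<notin> fst ` set n_as"
    by (auto simp: jordan_nf_def)
  from similar_matD[OF sim] A have J: "jordan_matrix n_as \<in> carrier_mat n n"
    by (auto simp del: jordan_matrix_carrier)
  then have "?D \<in> carrier_mat n n"
    using jordan_matrix_pow[of n_as m] by (metis pow_carrier_mat)
  then have "A ^\<^sub>m m = 0\<^sub>m n n \<longleftrightarrow> ?D = 0\<^sub>m (dim_row ?D) (dim_col ?D)"
    unfolding similar_mat_pow_eq_zero_iff[OF sim A] jordan_matrix_pow by auto
  also have "\<dots> \<longleftrightarrow> (\<forall>(k, a) \<in> set n_as. jordan_block k a ^\<^sub>m m = 0\<^sub>m k k)"
    unfolding diag_block_mat_eq_zero_iff by auto
  also have "\<dots> \<longleftrightarrow> (\<forall>(k, a) \<in> set n_as. a = 0 \<and> k \<le> m)"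
  proof (intro ball_cong refl, clarify)
    fix k a assume "(k, a) \<in> set n_as"
    with pos have "k \<noteq> 0" by (metis fst_conv image_eqI)
    then show "jordan_block k a ^\<^sub>m m = 0\<^sub>m k k \<longleftrightarrow> a = 0 \<and> k \<le> m"
      by (rule jordan_block_pow_eq_zero_iff)
  qed
  finally show ?thesis .
qed

text \<open>A nilpotent matrix of maximal index is a single Jordan block. With this criterion the normal
  form of a concrete matrix is read off from two of its powers, and no similarity has to be
  exhibited.\<close>
lemma jordan_nf_single_block:
  fixes A :: "complex mat"
  assumes A: "A \<in> carrier_mat n n"
    and zero: "A ^\<^sub>m n = 0\<^sub>m n n" and nonzero: "A ^\<^sub>m (n - 1) \<noteq> 0\<^sub>m n n"
  shows "jordan_nf A [(n, 0)]"
proof -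
  obtain n_as where nf: "jordan_nf A n_as"
    using char_poly_factorized[OF A] jordan_nf_exists[OF A] by metis
  then have sim: "similar_mat A (jordan_matrix n_as)" and pos: "0 \<notin> fst ` set n_as"
    by (auto simp: jordan_nf_def)
  have sizes: "sum_list (map fst n_as) = n"
    using similar_matD[OF sim] A by (metis carrier_matD(1) insert_subset jordan_matrix_dim(1))
  from zero have le: "\<forall>(k, a) \<in> set n_as. a = 0 \<and> k \<le> n"
    by (simp add: jordan_nf_pow_eq_zero_iff[OF A nf])
  \<comment> \<open>Some block is not annihilated by the power \<open>n - 1\<close>, so it fills the whole space.\<close>
  from nonzero obtain k a where ka: "(k, a) \<in> set n_as" and "\<not> (a = 0 \<and> k \<le> n - 1)"
    by (auto simp: jordan_nf_pow_eq_zero_iff[OF A nf])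
  with le have "k = n" "a = 0" by fastforce+
  with ka have "(n, 0) \<in> set n_as" by simp
  then obtain us vs where split: "n_as = us @ (n, 0) # vs" by (metis split_list)
  with sizes have "sum_list (map fst (us @ vs)) = 0" by auto
  then have "\<forall>x \<in> set (us @ vs). fst x = 0" by auto
  moreover have "\<forall>x \<in> set (us @ vs). fst x \<noteq> 0"
    using pos unfolding split by (metis Un_iff image_eqI list.set_intros(2) set_append)
  ultimately have "us @ vs = []"
    by (metis list.set_intros(1) neq_Nil_conv)
  then have "us = []" "vs = []" by simp_all
  with nf split show ?thesis by simp
qed

text \<open>The multiplicity of each block is determined by dimensions of generalised eigenspaces. This is
  what allows the blocks in which a matrix is given to be identified with those counted by its
  Segre characteristic.\<close>
lemma jordan_nf_mset_unique:
  fixes A :: "'a :: field mat"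
  assumes "jordan_nf A n_as" and "jordan_nf A m_bs"
  shows "mset n_as = mset m_bs"
proof (rule multiset_eqI)
  fix p :: "nat \<times> 'a"
  obtain k a where p: "p = (k, a)" by force
  have count: "count (mset xs) p = length (filter ((=) p) xs)" for xs
    by (simp add: count_mset count_list_eq_length_filter)
  show "count (mset n_as) p = count (mset m_bs) p"
  proof (cases "k = 0")
    case True
    with assms p have "p \<notin> set n_as" "p \<notin> set m_bs"
      by (force simp: jordan_nf_def)+
    then show ?thesis by (simp add: count_eq_zero_iff[THEN iffD2])
  next
    case False
    with compute_nr_of_jordan_blocks[OF assms(1)] compute_nr_of_jordan_blocks[OF assms(2)]
    show ?thesis by (metis count p)
  qed
qed

section \<open>Nilpotent \<open>H\<close>-nonnegative matrices square to zero\<close>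

lemma quadratic_form_add_smult:
  fixes M :: "complex mat"
  assumes M: "M \<in> carrier_mat n n" and y: "y \<in> carrier_vec n" and z: "z \<in> carrier_vec n"
  shows "(M *\<^sub>v (y + t \<cdot>\<^sub>v z)) \<bullet>c (y + t \<cdot>\<^sub>v z)
           = (M *\<^sub>v y) \<bullet>c y + cnj t * ((M *\<^sub>v y) \<bullet>c z)
             + t * ((M *\<^sub>v z) \<bullet>c y) + (cmod t)\<^sup>2 * ((M *\<^sub>v z) \<bullet>c z)"
proof -
  have c: "M *\<^sub>v y \<in> carrier_vec n" "M *\<^sub>v z \<in> carrier_vec n" using M y z by auto
  have "(M *\<^sub>v (y + t \<cdot>\<^sub>v z)) \<bullet>c (y + t \<cdot>\<^sub>v z)
      = (M *\<^sub>v y + t \<cdot>\<^sub>v (M *\<^sub>v z)) \<bullet> (conjugate y + cnj t \<cdot>\<^sub>v conjugate z)"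
    using M y z
    by (simp add: mult_add_distrib_mat_vec[OF M] mult_mat_vec[OF M] conjugate_add_vec[of _ n]
        conjugate_smult_vec)
  also have "\<dots> = (M *\<^sub>v y) \<bullet>c y + cnj t * ((M *\<^sub>v y) \<bullet>c z)
             + t * ((M *\<^sub>v z) \<bullet>c y) + (t * cnj t) * ((M *\<^sub>v z) \<bullet>c z)"
    using c y z
    by (simp add: add_scalar_prod_distrib[of _ n] scalar_prod_add_distrib[of _ n] algebra_simps)
  finally show ?thesis unfolding complex_norm_square .
qed

text \<open>Over the complex numbers a quadratic form with real values has a Hermitian polar form. Hence
  \<open>H B\<close> is Hermitian when it is nonnegative, so that \<open>B\<close> is selfadjoint for \<open>[\<cdot>,\<cdot>]\<close>.\<close>
lemma nonneg_form_hermitian: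
  fixes M :: "complex mat"
  assumes M: "M \<in> carrier_mat n n"
    and nonneg: "\<And>x. x \<in> carrier_vec n \<Longrightarrow> 0 \<le> (M *\<^sub>v x) \<bullet>c x"
    and y: "y \<in> carrier_vec n" and z: "z \<in> carrier_vec n"
  shows "(M *\<^sub>v z) \<bullet>c y = cnj ((M *\<^sub>v y) \<bullet>c z)"
proof -
  have im: "Im (cnj t * ((M *\<^sub>v y) \<bullet>c z) + t * ((M *\<^sub>v z) \<bullet>c y)) = 0" for t
    using nonneg[of "y + t \<cdot>\<^sub>v z"] nonneg[OF y] nonneg[OF z] y z
    unfolding quadratic_form_add_smult[OF M y z, of t]
    by (simp add: less_eq_complex_def flip: of_real_power)
  \<comment> \<open>\<open>t = 1\<close> compares the imaginary parts of the two mixed terms, \<open>t = \<i>\<close> their real parts.\<close>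
  from im[of 1] im[of \<i>] show ?thesis by (simp add: complex_eq_iff)
qed

text \<open>The equality case of Cauchy--Schwarz: with \<open>z = M y\<close>, the form at \<open>y - s z\<close> has
  no term of order 0 in \<open>s\<close>, so nonnegativity for small \<open>s\<close> forces the linear coefficient
  \<open>-2 (z, z)\<close> to vanish.\<close>
lemma nonneg_form_isotropic_in_kernel:
  fixes M :: "complex mat"
  assumes M: "M \<in> carrier_mat n n"
    and nonneg: "\<And>x. x \<in> carrier_vec n \<Longrightarrow> 0 \<le> (M *\<^sub>v x) \<bullet>c x"
    and y: "y \<in> carrier_vec n" and iso: "(M *\<^sub>v y) \<bullet>c y = 0"
  shows "M *\<^sub>v y = 0\<^sub>v n"
proof -
  define z where "z = M *\<^sub>v y"
  have z: "z \<in> carrier_vec n" using M y by (simp add: z_def)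
  define p q where "p = Re (z \<bullet>c z)" and "q = Re ((M *\<^sub>v z) \<bullet>c z)"
  have zz: "z \<bullet>c z = of_real p"
    using conjugate_square_ge_0_vec[of z] by (simp add: p_def complex_eq_iff less_eq_complex_def)
  have Mzz: "(M *\<^sub>v z) \<bullet>c z = of_real q" and q: "q \<ge> 0"
    using nonneg[OF z] by (simp_all add: q_def complex_eq_iff less_eq_complex_def)
  have Mzy: "(M *\<^sub>v z) \<bullet>c y = of_real p"
    using nonneg_form_hermitian[OF M nonneg y z] zz by (simp add: z_def[symmetric])
  \<comment> \<open>The minimiser of \<open>s\<^sup>2 q - 2 s p\<close> is \<open>p / q\<close>; the shifted denominator also covers \<open>q = 0\<close>.\<close>
  define s where "s = p / (q + 1)"
  have zy: "z \<bullet>c y = 0" using iso by (simp add: z_def)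
  have "0 \<le> (M *\<^sub>v (y + of_real (- s) \<cdot>\<^sub>v z)) \<bullet>c (y + of_real (- s) \<cdot>\<^sub>v z)"
    using nonneg y z by simp
  then have "0 \<le> - 2 * s * p + s\<^sup>2 * q"
    unfolding quadratic_form_add_smult[OF M y z, of "of_real (- s)"] Mzz Mzy
      z_def[symmetric] zy zz
    by (simp add: less_eq_complex_def mult_ac flip: of_real_power)
  also have "\<dots> = - (p\<^sup>2 * (q + 2) / (q + 1)\<^sup>2)"
    using q by (simp add: s_def power2_eq_square divide_simps) (simp add: algebra_simps)
  finally have "p\<^sup>2 * (q + 2) / (q + 1)\<^sup>2 \<le> 0" by simp
  with q have "p\<^sup>2 \<le> 0" by (simp add: divide_le_0_iff mult_le_0_iff)
  then have "p = 0" by simp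
  with zz z show ?thesis by (simp add: z_def)
qed

lemma hermitian_mat_cscalar_prod:
  assumes H: "H \<in> carrier_mat n n" and herm: "hermitian_mat H"
    and u: "u \<in> carrier_vec n" and v: "v \<in> carrier_vec n"
  shows "(H *\<^sub>v u) \<bullet>c v = u \<bullet>c (H *\<^sub>v v)"
proof -
  have entry: "H $$ (i,j) = cnj (H $$ (j,i))" if "i < n" "j < n" for i j
  proof -
    have "H $$ (i,j) = mat_adjoint H $$ (i,j)"
      using herm by (simp add: hermitian_mat_def)
    also have "\<dots> = cnj (H $$ (j,i))"
      using that H by (simp add: mat_adjoint_def mat_of_rows_index)
    finally show ?thesis .
  qed
  have "(H *\<^sub>v u) \<bullet>c v = (\<Sum>i = 0..<n. \<Sum>j = 0..<n. H $$ (i,j) * u $ j * cnj (v $ i))"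
    using H u v by (simp add: scalar_prod_def sum_distrib_right)
  also have "\<dots> = (\<Sum>j = 0..<n. \<Sum>i = 0..<n. u $ j * cnj (H $$ (j,i) * v $ i))"
    by (subst sum.swap) (auto intro!: sum.cong simp: entry[symmetric])
  also have "\<dots> = u \<bullet>c (H *\<^sub>v v)"
    using H u v by (simp add: scalar_prod_def sum_distrib_left)
  finally show ?thesis .
qed

text \<open>If \<open>B\<^sup>3 x = 0\<close>, then \<open>B x\<close> is isotropic for the nonnegative form \<open>[B u, u]\<close>, because
  \<open>[B (B x), B x] = [B\<^sup>3 x, x]\<close>. It therefore lies in the kernel of \<open>H B\<close>, which is the kernel of
  \<open>B\<close> since \<open>H\<close> is invertible.\<close>
lemma H_nonnegative_cube_kernel:
  assumes H: "H \<in> carrier_mat n n" and inv: "invertible_mat H" and herm: "hermitian_mat H"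
    and B: "B \<in> carrier_mat n n" and nonneg: "H_nonnegative H B"
    and x: "x \<in> carrier_vec n" and cube: "B *\<^sub>v (B *\<^sub>v (B *\<^sub>v x)) = 0\<^sub>v n"
  shows "B *\<^sub>v (B *\<^sub>v x) = 0\<^sub>v n"
proof -
  define y where "y = B *\<^sub>v x"
  have y: "y \<in> carrier_vec n" and By: "B *\<^sub>v y \<in> carrier_vec n"
    using B x by (simp_all add: y_def)
  have M: "H * B \<in> carrier_mat n n" using H B by simp
  have M_vec: "(H * B) *\<^sub>v u = H *\<^sub>v (B *\<^sub>v u)" if "u \<in> carrier_vec n" for u
    using H B that by simp
  have zero_image: "H *\<^sub>v 0\<^sub>v n = 0\<^sub>v n" using H by (intro eq_vecI) auto
  have form: "0 \<le> ((H * B) *\<^sub>v u) \<bullet>c u" if "u \<in> carrier_vec n" for u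
    using nonneg H that by (simp add: H_nonnegative_def indef_inner_def M_vec)
  \<comment> \<open>\<open>[By, y] = [By, Bx]\<close>, and moving the last \<open>B\<close> to the left produces \<open>[B\<^sup>3 x, x]\<close>.\<close>
  have "((H * B) *\<^sub>v y) \<bullet>c y = (B *\<^sub>v y) \<bullet>c ((H * B) *\<^sub>v x)"
    using hermitian_mat_cscalar_prod[OF H herm By y] x y by (simp add: M_vec y_def)
  also have "\<dots> = cnj (((H * B) *\<^sub>v x) \<bullet>c (B *\<^sub>v y))"
    using conjugate_conjugate_sprod[of "B *\<^sub>v y" n "(H * B) *\<^sub>v x"]
      conjugate_vec_sprod_comm[of "(H * B) *\<^sub>v x" n "B *\<^sub>v y"] By M x by simp
  also have "\<dots> = ((H * B) *\<^sub>v (B *\<^sub>v y)) \<bullet>c x"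
    using nonneg_form_hermitian[OF M form x By] by simp
  also have "\<dots> = 0"
    using cube By x H zero_image by (simp add: M_vec y_def)
  finally have "((H * B) *\<^sub>v y) \<bullet>c y = 0" .
  then have HBy: "H *\<^sub>v (B *\<^sub>v y) = 0\<^sub>v n"
    using nonneg_form_isotropic_in_kernel[OF M form y] M_vec y by simp
  from inv H obtain K where K: "K * H = 1\<^sub>m (dim_row K)" "H * K = 1\<^sub>m n"
    by (auto simp: invertible_mat_def inverts_mat_def)
  have "K \<in> carrier_mat n n"
    using K H by (metis carrier_matD carrier_matI index_mult_mat(2,3) index_one_mat(2,3))
  with K H By have "B *\<^sub>v y = K *\<^sub>v (H *\<^sub>v (B *\<^sub>v y))"
    by (metis assoc_mult_mat_vec carrier_matD(1) one_mult_mat_vec)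
  also have "\<dots> = 0\<^sub>v n"
    unfolding HBy using \<open>K \<in> carrier_mat n n\<close> by (intro eq_vecI) auto
  finally show ?thesis by (simp add: y_def)
qed

lemma mat_eq_zeroI:
  fixes A :: "'a :: semiring_1 mat"
  assumes A: "A \<in> carrier_mat nr nc"
    and zero: "\<And>x. x \<in> carrier_vec nc \<Longrightarrow> A *\<^sub>v x = 0\<^sub>v nr"
  shows "A = 0\<^sub>m nr nc"
proof (rule mat_col_eqI)
  fix j assume "j < dim_col (0\<^sub>m nr nc :: 'a mat)"
  then have j: "j < nc" by simp
  then have "col A j = A *\<^sub>v unit_vec nc j"
    using A by (intro eq_vecI) simp_all
  also have "\<dots> = 0\<^sub>v nr" by (rule zero) simp
  also have "\<dots> = col (0\<^sub>m nr nc) j" using j by simp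
  finally show "col A j = col (0\<^sub>m nr nc) j" .
qed (use A in auto)

text \<open>Applied to the vectors \<open>B\<^sup>j x\<close>, the step from \<open>B\<^sup>3\<close> to \<open>B\<^sup>2\<close> lowers any vanishing power
  with exponent above 2 by one.\<close>
lemma H_nonnegative_nilpotent_square_zero:
  assumes H: "H \<in> carrier_mat n n" and inv: "invertible_mat H" and herm: "hermitian_mat H"
    and B: "B \<in> carrier_mat n n" and nonneg: "H_nonnegative H B" and nil: "nilpotent_mat B"
  shows "B ^\<^sub>m 2 = 0\<^sub>m n n"
proof -
  have pow: "B ^\<^sub>m (Suc j) *\<^sub>v x = B *\<^sub>v (B ^\<^sub>m j *\<^sub>v x)" if "x \<in> carrier_vec n" for j x
  proof -
    have "B ^\<^sub>m Suc j = B * B ^\<^sub>m j"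
      using B by (induction j) (simp_all add: assoc_mult_mat[of _ n n _ n _ n])
    with B that show ?thesis by (simp add: assoc_mult_mat_vec[of _ n n _ n] del: pow_mat.simps)
  qed
  have descend: "B ^\<^sub>m (j + 2) = 0\<^sub>m n n \<Longrightarrow> B ^\<^sub>m 2 = 0\<^sub>m n n" for j
  proof (induction j)
    case (Suc j)
    have "B ^\<^sub>m (j + 2) *\<^sub>v x = 0\<^sub>v n" if x: "x \<in> carrier_vec n" for x
    proof -
      have "B ^\<^sub>m (Suc j + 2) *\<^sub>v x = 0\<^sub>v n"
        unfolding Suc.prems using x by (intro eq_vecI) auto
      then show ?thesis
        using H_nonnegative_cube_kernel[OF H inv herm B nonneg, of "B ^\<^sub>m j *\<^sub>v x"]
          x pow_carrier_mat[OF B, of j]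
        by (simp add: pow del: pow_mat.simps)
    qed
    then have "B ^\<^sub>m (j + 2) = 0\<^sub>m n n"
      using B by (intro mat_eq_zeroI) (auto simp del: pow_mat.simps)
    then show ?case by (rule Suc.IH)
  qed (simp only: add_0)
  from nil B obtain k where "B ^\<^sub>m k = 0\<^sub>m n n" by (auto simp: nilpotent_mat_def)
  \<comment> \<open>The exponent is raised by 2 because the descent ends at the second power and \<open>k\<close> may be smaller.\<close>
  then have "B ^\<^sub>m (k + 2) = 0\<^sub>m n n" using B by (simp add: numeral_2_eq_2)
  then show ?thesis by (rule descend)
qed

section \<open>Segre pairings of matrices with square zero\<close>

lemma sum_pair_blocks:
  "(\<Sum>p\<in>#S. mset (pair_blocks p))
     = image_mset J (filter_mset (\<lambda>k. k \<noteq> 0) (\<Sum>p\<in>#S. {#fst p, snd p#}))"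
  by (induction S) (simp_all add: pair_blocks_def)

text \<open>The first entry of a pair is always a block size, hence 1 or 2 when the square vanishes; the
  second differs from it by at most one and does not exceed it.\<close>
lemma segre_pairing_entries:
  assumes sq: "B ^\<^sub>m 2 = 0\<^sub>m n n" and B: "B \<in> carrier_mat n n"
    and pairing: "segre_pairing B S" and p: "p \<in> set_mset S"
  shows "p \<in> {(2, 2), (2, 1), (1, 1), (1, 0)}"
proof -
  from pairing obtain ns where nf: "jordan_nf B (map (\<lambda>k. (k, 0)) ns)"
    and pairs: "\<forall>(a, b) \<in> set_mset S. a \<in> set ns \<and> (b \<in> set ns \<or> b = 0) \<and> b \<le> a \<and> a \<le> b + 1"
    by (auto simp: segre_pairing_def segre_characteristic_def)
  obtain a b where ab: "p = (a, b)" by force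
  with pairs p have mem: "a \<in> set ns" and order: "b \<le> a" "a \<le> b + 1" by auto
  from mem nf have "a \<noteq> 0" by (force simp: jordan_nf_def)
  moreover have "a \<le> 2"
    using jordan_nf_pow_eq_zero_iff[OF B nf, of 2] sq mem by auto
  ultimately have "a = 1 \<or> a = 2" by arith
  with order ab show ?thesis by auto
qed

lemma segre_pairing_blocks:
  assumes nf: "jordan_nf B n_as" and pairing: "segre_pairing B S"
  shows "image_mset (\<lambda>(k, a). jordan_block k a) (mset n_as) = (\<Sum>p\<in>#S. mset (pair_blocks p))"
proof -
  from pairing obtain ns where ns: "jordan_nf B (map (\<lambda>k. (k, 0)) ns)"
    and entries: "filter_mset (\<lambda>k. k \<noteq> 0) (\<Sum>p\<in>#S. {#fst p, snd p#}) = mset ns"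
    by (auto simp: segre_pairing_def segre_characteristic_def)
  have "image_mset (\<lambda>(k, a). jordan_block k a) (mset n_as) = image_mset J (mset ns)"
    unfolding jordan_nf_mset_unique[OF nf ns] mset_map by (simp add: multiset.map_comp o_def)
  also have "\<dots> = (\<Sum>p\<in>#S. mset (pair_blocks p))"
    unfolding sum_pair_blocks entries ..
  finally show ?thesis .
qed

section \<open>Matrix equations in coordinates\<close>

lemma mat_eq_iff_entries:
  assumes "A \<in> carrier_mat nr nc" "B \<in> carrier_mat nr nc"
  shows "A = B \<longleftrightarrow> (\<forall>i<nr. \<forall>j<nc. A $$ (i,j) = B $$ (i,j))"
  using assms by (auto intro!: eq_matI)

lemma mat_mult_eq_iff_entries:
  assumes "A \<in> carrier_mat n n" "B \<in> carrier_mat n n" "C \<in> carrier_mat n n"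
  shows "A * B = C \<longleftrightarrow> (\<forall>i<n. \<forall>j<n. (\<Sum>k<n. A $$ (i,k) * B $$ (k,j)) = C $$ (i,j))"
  using assms mult_carrier_mat[OF assms(1,2)]
  by (subst mat_eq_iff_entries[of _ n n]) (simp_all add: scalar_prod_def lessThan_atLeast0)

lemma All_less_2: "(\<forall>i<2. P i) \<longleftrightarrow> P 0 \<and> P (1::nat)"
  by (auto simp: All_less_Suc numeral_2_eq_2)
lemma All_less_3: "(\<forall>i<3. P i) \<longleftrightarrow> P 0 \<and> P 1 \<and> P (2::nat)"
  by (simp add: All_less_Suc numeral_3_eq_3 numeral_2_eq_2 conj_ac)
lemma All_less_4: "(\<forall>i<4. P i) \<longleftrightarrow> P 0 \<and> P 1 \<and> P 2 \<and> P (3::nat)"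
  by (simp add: All_less_Suc eval_nat_numeral conj_ac)
lemma sum_less_2: "(\<Sum>i<2. f i) = f 0 + (f (1::nat) :: 'a :: comm_monoid_add)"
  by (simp add: numeral_2_eq_2)
lemma sum_less_3: "(\<Sum>i<3. f i) = f 0 + f 1 + (f (2::nat) :: 'a :: comm_monoid_add)"
  by (simp add: eval_nat_numeral)
lemma sum_less_4: "(\<Sum>i<4. f i) = f 0 + f 1 + f 2 + (f (3::nat) :: 'a :: comm_monoid_add)"
  by (simp add: eval_nat_numeral)

lemma mat_of_rows_list_carrier:
  "length rs = nr \<Longrightarrow> mat_of_rows_list nc rs \<in> carrier_mat nr nc"
  by (auto simp: mat_of_rows_list_def)

lemma mat_of_rows_list_index:
  "i < length rs \<Longrightarrow> j < nc \<Longrightarrow> mat_of_rows_list nc rs $$ (i,j) = rs ! i ! j"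
  by (auto simp: mat_of_rows_list_def)

text \<open>These rule sets turn an equation between matrices of a fixed small size into the explicit list
  of scalar equations.\<close>
lemmas two_simps = All_less_2 sum_less_2 mat_of_rows_list_carrier mat_of_rows_list_index
lemmas three_simps = All_less_3 sum_less_3 mat_of_rows_list_carrier mat_of_rows_list_index
lemmas four_simps = All_less_4 sum_less_4 mat_of_rows_list_carrier mat_of_rows_list_index

text \<open>A square root commutes with its square. These linear equations already fix the zero pattern of
  the root, and only few quadratic equations remain to be solved.\<close>
lemma square_root_commutes_entries:
  assumes A: "A \<in> carrier_mat n n" and B: "B \<in> carrier_mat n n" and sq: "A * A = B"
  shows "\<forall>i<n. \<forall>j<n. (\<Sum>k<n. A $$ (i,k) * B $$ (k,j)) = (\<Sum>k<n. B $$ (i,k) * A $$ (k,j))"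
proof -
  have "A * B = B * A" using A sq by auto
  then show ?thesis
    unfolding mat_mult_eq_iff_entries[OF A B mult_carrier_mat[OF B A]]
    using A B by (simp add: scalar_prod_def flip: lessThan_atLeast0)
qed

lemma pow_mat_small:
  fixes A :: "'a :: semiring_1 mat"
  assumes A: "A \<in> carrier_mat n n"
  shows "A ^\<^sub>m 2 = A * A" "A ^\<^sub>m 3 = A * A * A" "A ^\<^sub>m 4 = A * A * (A * A)"
  using A by (simp_all add: eval_nat_numeral assoc_mult_mat[of _ n n _ n _ n])

section \<open>Square roots of \<open>J 1\<close> and \<open>J 1 \<oplus> J 1\<close>\<close>

lemma square_roots_J1: "{A. square_root A (J 1)} = {mat_of_rows_list 1 [[0]]}"
proof -
  have J1: "J 1 \<in> carrier_mat 1 1" by simp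
  have Z: "mat_of_rows_list 1 [[0]] \<in> carrier_mat 1 1" by (simp add: mat_of_rows_list_carrier)
  have "square_root A (J 1) \<longleftrightarrow> A = mat_of_rows_list 1 [[0]]" for A
  proof (cases "A \<in> carrier_mat 1 1")
    case True
    then show ?thesis
      unfolding square_root_def mat_mult_eq_iff_entries[OF True True J1]
        mat_eq_iff_entries[OF True Z]
      by (simp add: mat_of_rows_list_index)
  next
    case False
    with Z show ?thesis by (auto simp: square_root_def)
  qed
  then show ?thesis by auto
qed

lemma jordan_nf_zero_1: "jordan_nf (mat_of_rows_list 1 [[0 :: complex]]) [(1, 0)]"
proof (rule jordan_nf_single_block)
  show Z: "mat_of_rows_list 1 [[0 :: complex]] \<in> carrier_mat 1 1"
    by (simp add: mat_of_rows_list_carrier)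
  then show "mat_of_rows_list 1 [[0 :: complex]] ^\<^sub>m 1 = 0\<^sub>m 1 1"
    by (simp add: mat_eq_iff_entries[of _ 1 1] mat_of_rows_list_index)
  have "(1\<^sub>m 1 :: complex mat) $$ (0,0) \<noteq> 0\<^sub>m 1 1 $$ (0,0)" by simp
  then have "(1\<^sub>m 1 :: complex mat) \<noteq> 0\<^sub>m 1 1" by metis
  with Z show "mat_of_rows_list 1 [[0 :: complex]] ^\<^sub>m (1 - 1) \<noteq> 0\<^sub>m 1 1" by simp
qed

lemma diag_J1_J1: "diag_block_mat [J 1, J 1] = mat_of_rows_list 2 [[0,0],[0,0]]"
proof -
  have "diag_block_mat [J 1, J 1] \<in> carrier_mat 2 2"
    by (rule carrier_matI) (simp_all add: Let_def)
  then show ?thesis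
    by (subst mat_eq_iff_entries[of _ 2 2]) (simp_all add: two_simps Let_def)
qed

lemma root11a_square:
  assumes "\<beta> \<noteq> 0"
  shows "root11a \<alpha> \<beta> * root11a \<alpha> \<beta> = diag_block_mat [J 1, J 1]"
  unfolding diag_J1_J1 root11a_def using assms
  by (subst mat_mult_eq_iff_entries[of _ 2]) (simp_all add: two_simps power2_eq_square)

lemma root11b_square: "root11b \<alpha> * root11b \<alpha> = diag_block_mat [J 1, J 1]"
  unfolding diag_J1_J1 root11b_def
  by (subst mat_mult_eq_iff_entries[of _ 2]) (simp_all add: two_simps)

text \<open>A square root of the zero matrix has trace 0 and determinant 0. The two families are separated
  by the lower left entry; when it is nonzero, the entry above the diagonal is determined.\<close>
lemma square_root_J1_J1_cases:
  assumes A: "A \<in> carrier_mat 2 2" and sq: "A * A = diag_block_mat [J 1, J 1]"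
  shows "(\<exists>\<alpha> \<beta>. \<beta> \<noteq> 0 \<and> A = root11a \<alpha> \<beta>) \<or> (\<exists>\<alpha>. A = root11b \<alpha>)"
proof -
  let ?N = "mat_of_rows_list 2 [[0,0],[0,0]] :: complex mat"
  have N: "?N \<in> carrier_mat 2 2" by (simp add: mat_of_rows_list_carrier)
  define a b c d where abcd: "a = A $$ (0,0)" "b = A $$ (0,1)" "c = A $$ (1,0)" "d = A $$ (1,1)"
  have e: "a * a + b * c = 0" "a * b + b * d = 0" "c * a + d * c = 0" "c * b + d * d = 0"
    using sq[unfolded diag_J1_J1 mat_mult_eq_iff_entries[OF A A N]]
    by (simp_all add: two_simps abcd[symmetric, unfolded One_nat_def])
  show ?thesis
  proof (cases "c = 0")
    case True
    with e have "a = 0" "d = 0" by simp_all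
    with True have "A = root11b b"
      unfolding root11b_def
      by (subst mat_eq_iff_entries[OF A])
        (simp_all add: two_simps abcd[symmetric, unfolded One_nat_def])
    then show ?thesis by blast
  next
    case False
    have "c * (a + d) = 0" using e(3) by (simp add: algebra_simps)
    with False have d: "d = - a" by (simp add: add_eq_0_iff)
    have b: "b = - a\<^sup>2 / c"
      using e(1) False by (simp add: field_simps power2_eq_square add_eq_0_iff2)
    with d have "A = root11a a c"
      unfolding root11a_def
      by (subst mat_eq_iff_entries[OF A])
        (simp_all add: two_simps abcd[symmetric, unfolded One_nat_def])
    with False show ?thesis by blast
  qed
qed

lemma square_roots_J1_J1:
  "{A. square_root A (diag_block_mat [J 1, J 1])}
     = {root11a \<alpha> \<beta> | \<alpha> \<beta>. \<beta> \<noteq> 0} \<union> {root11b \<alpha> | \<alpha>. True}" (is "?L = ?R")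
proof -
  have dim: "dim_row (diag_block_mat [J 1, J 1]) = 2"
    unfolding diag_J1_J1 by (simp add: mat_of_rows_list_def)
  have "root11a \<alpha> \<beta> \<in> carrier_mat 2 2" "root11b \<alpha> \<in> carrier_mat 2 2" for \<alpha> \<beta>
    by (simp_all add: root11a_def root11b_def mat_of_rows_list_carrier)
  then have "?R \<subseteq> ?L"
    unfolding square_root_def dim using root11a_square root11b_square by auto
  moreover have "?L \<subseteq> ?R"
    unfolding square_root_def dim using square_root_J1_J1_cases by blast
  ultimately show ?thesis by (rule subset_antisym[rotated])
qed

lemma jordan_nf_two_of_square_zero:
  assumes A: "A \<in> carrier_mat 2 2" and sq: "A * A = diag_block_mat [J 1, J 1]"
    and nz: "A $$ (0,1) \<noteq> 0 \<or> A $$ (1,0) \<noteq> 0"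
  shows "jordan_nf A [(2, 0)]"
proof (rule jordan_nf_single_block[OF A])
  have "mat_of_rows_list 2 [[0,0],[0,0]] = (0\<^sub>m 2 2 :: complex mat)"
    by (subst mat_eq_iff_entries[of _ 2 2]) (simp_all add: two_simps)
  then show "A ^\<^sub>m 2 = 0\<^sub>m 2 2"
    by (simp only: pow_mat_small[OF A] sq diag_J1_J1)
  show "A ^\<^sub>m (2 - 1) \<noteq> 0\<^sub>m 2 2"
    using nz A by auto
qed

lemma jordan_nf_root11a:
  assumes "\<beta> \<noteq> 0"
  shows "jordan_nf (root11a \<alpha> \<beta>) [(2, 0)]"
  using assms root11a_square[OF assms, of \<alpha>]
  by (intro jordan_nf_two_of_square_zero)
    (simp_all only: root11a_def two_simps, simp_all add: two_simps)

lemma jordan_nf_root11b: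
  assumes "\<alpha> \<noteq> 0"
  shows "jordan_nf (root11b \<alpha>) [(2, 0)]"
  using assms root11b_square[of \<alpha>]
  by (intro jordan_nf_two_of_square_zero)
    (simp_all only: root11b_def two_simps, simp_all add: two_simps)

lemma jordan_nf_root11b_zero: "jordan_nf (root11b 0) [(1, 0), (1, 0)]"
proof -
  have "root11b 0 = jordan_matrix [(1, 0), (1, 0)]"
    unfolding jordan_matrix_def root11b_def
    by (simp only: list.map prod.case diag_J1_J1)
  then show ?thesis
    unfolding jordan_nf_def using similar_mat_refl[OF jordan_matrix_carrier] by simp
qed

section \<open>Square roots of \<open>J 2 \<oplus> J 1\<close>\<close>

lemma diag_J2_J1: "diag_block_mat [J 2, J 1] = mat_of_rows_list 3 [[0,1,0],[0,0,0],[0,0,0]]"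
proof -
  have "diag_block_mat [J 2, J 1] \<in> carrier_mat 3 3"
    by (rule carrier_matI) (simp_all add: Let_def)
  then show ?thesis
    by (subst mat_eq_iff_entries[of _ 3 3]) (simp_all add: three_simps Let_def)
qed

lemma root21_square:
  assumes "\<beta> \<noteq> 0"
  shows "root21 \<alpha> \<beta> * root21 \<alpha> \<beta> = diag_block_mat [J 2, J 1]"
  unfolding diag_J2_J1 root21_def using assms
  by (subst mat_mult_eq_iff_entries[of _ 3]) (simp_all add: three_simps)

lemma square_root_J2_J1_cases:
  assumes A: "A \<in> carrier_mat 3 3" and sq: "A * A = diag_block_mat [J 2, J 1]"
  shows "\<exists>\<alpha> \<beta>. \<beta> \<noteq> 0 \<and> A = root21 \<alpha> \<beta>"
proof -
  let ?N = "mat_of_rows_list 3 [[0,1,0],[0,0,0],[0,0,0]] :: complex mat"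
  have N: "?N \<in> carrier_mat 3 3" by (simp add: mat_of_rows_list_carrier)
  note sq = sq[unfolded diag_J2_J1]
  have c: "A $$ (1,0) = 0" "A $$ (1,1) = A $$ (0,0)" "A $$ (1,2) = 0" "A $$ (2,0) = 0"
    using square_root_commutes_entries[OF A N sq] by (simp_all add: three_simps)
  have e: "A $$ (0,0) = 0" "A $$ (2,2) = 0" "A $$ (0,2) * A $$ (2,1) = 1"
    using sq[unfolded mat_mult_eq_iff_entries[OF A A N]]
    by (auto simp: three_simps c[unfolded One_nat_def])
  from e(3) have nz: "A $$ (0,2) \<noteq> 0" by auto
  with e(3) have inv: "A $$ (2,1) = 1 / A $$ (0,2)" by (simp add: field_simps)
  have "A = root21 (A $$ (0,1)) (A $$ (0,2))"
    unfolding root21_def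
    by (subst mat_eq_iff_entries[OF A])
      (simp_all add: three_simps c[unfolded One_nat_def] e inv[unfolded One_nat_def])
  with nz show ?thesis by blast
qed

lemma square_roots_J2_J1:
  "{A. square_root A (diag_block_mat [J 2, J 1])} = {root21 \<alpha> \<beta> | \<alpha> \<beta>. \<beta> \<noteq> 0}"
    (is "?L = ?R")
proof -
  have dim: "dim_row (diag_block_mat [J 2, J 1]) = 3"
    unfolding diag_J2_J1 by (simp add: mat_of_rows_list_def)
  have "root21 \<alpha> \<beta> \<in> carrier_mat 3 3" for \<alpha> \<beta>
    by (simp add: root21_def mat_of_rows_list_carrier)
  then have "?R \<subseteq> ?L"
    unfolding square_root_def dim using root21_square by auto
  moreover have "?L \<subseteq> ?R"
    unfolding square_root_def dim using square_root_J2_J1_cases by blast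
  ultimately show ?thesis by (rule subset_antisym[rotated])
qed

text \<open>The square \<open>J 2 \<oplus> J 1\<close> is nonzero, while the cube vanishes because the middle row of the root
  is zero.\<close>
lemma jordan_nf_root21:
  assumes "\<beta> \<noteq> 0"
  shows "jordan_nf (root21 \<alpha> \<beta>) [(3, 0)]"
proof (rule jordan_nf_single_block)
  let ?A = "root21 \<alpha> \<beta>"
  let ?N = "mat_of_rows_list 3 [[0,1,0],[0,0,0],[0,0,0]] :: complex mat"
  show A: "?A \<in> carrier_mat 3 3" by (simp add: root21_def mat_of_rows_list_carrier)
  have "?N * ?A = 0\<^sub>m 3 3"
    unfolding root21_def
    by (subst mat_mult_eq_iff_entries[of _ 3]) (simp_all add: three_simps)
  then show "?A ^\<^sub>m 3 = 0\<^sub>m 3 3"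
    by (simp only: pow_mat_small[OF A] root21_square[OF assms] diag_J2_J1)
  have "?N $$ (0,1) = 1" by (simp add: three_simps)
  then have "?N \<noteq> 0\<^sub>m 3 3" by auto
  moreover have "?A ^\<^sub>m 2 = ?N"
    by (simp only: pow_mat_small[OF A] root21_square[OF assms] diag_J2_J1)
  ultimately show "?A ^\<^sub>m (3 - 1) \<noteq> 0\<^sub>m 3 3" by simp
qed

section \<open>Square roots of \<open>J 2 \<oplus> J 2\<close>\<close>

lemma diag_J2_J2:
  "diag_block_mat [J 2, J 2] = mat_of_rows_list 4 [[0,1,0,0],[0,0,0,0],[0,0,0,1],[0,0,0,0]]"
proof -
  have "diag_block_mat [J 2, J 2] \<in> carrier_mat 4 4"
    by (rule carrier_matI) (simp_all add: Let_def)
  then show ?thesis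
    by (subst mat_eq_iff_entries[of _ 4 4]) (simp_all add: four_simps Let_def)
qed

text \<open>With \<open>N = J 2\<close>, this is \<open>X \<otimes> 1 + Y \<otimes> N\<close> for \<open>X = [[a, y], [z, x]]\<close> and
  \<open>Y = [[p, q], [r, s]]\<close>: the general matrix commuting with \<open>J 2 \<oplus> J 2 = 1 \<otimes> N\<close>.\<close>
definition block_toeplitz ::
  "complex \<Rightarrow> complex \<Rightarrow> complex \<Rightarrow> complex \<Rightarrow> complex \<Rightarrow> complex \<Rightarrow> complex \<Rightarrow> complex \<Rightarrow> complex mat" where
  "block_toeplitz a p y q z r x s = mat_of_rows_list 4
     [[a, p, y, q],
      [0, a, 0, y],
      [z, r, x, s],
      [0, z, 0, x]]"

text \<open>As \<open>N\<^sup>2 = 0\<close>, the square is \<open>X\<^sup>2 \<otimes> 1 + (X Y + Y X) \<otimes> N\<close>; the equations are the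
  entries of \<open>X\<^sup>2 = 0\<close> and of \<open>X Y + Y X = 1\<close>.\<close>
lemma block_toeplitz_square:
  "block_toeplitz a p y q z r x s * block_toeplitz a p y q z r x s = diag_block_mat [J 2, J 2]
   \<longleftrightarrow> a * a + y * z = 0 \<and> a * y + y * x = 0 \<and> z * a + x * z = 0 \<and> z * y + x * x = 0
     \<and> a * p + p * a + y * r + q * z = 1 \<and> a * q + p * y + y * s + q * x = 0
     \<and> z * p + r * a + x * r + s * z = 0 \<and> z * q + r * y + x * s + s * x = 1"
  unfolding diag_J2_J2 block_toeplitz_def
  by (subst mat_mult_eq_iff_entries[of _ 4]) (auto simp: four_simps)

lemma root22a_block_toeplitz:
  "root22a \<alpha>1 \<alpha>2 \<alpha>3 \<alpha>4
     = block_toeplitz (- \<alpha>3) (- \<alpha>4) (- \<alpha>3\<^sup>2 / \<alpha>1)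
         (1 / \<alpha>1\<^sup>2 * (\<alpha>1 + \<alpha>3\<^sup>2 * \<alpha>2 - 2 * \<alpha>1 * \<alpha>3 * \<alpha>4)) \<alpha>1 \<alpha>2 \<alpha>3 \<alpha>4"
  by (simp add: root22a_def block_toeplitz_def Let_def)

lemma root22b_block_toeplitz:
  "root22b \<gamma>1 \<gamma>2 \<gamma>3 = block_toeplitz 0 \<gamma>1 \<gamma>2 \<gamma>3 0 (1 / \<gamma>2) 0 (- \<gamma>1)"
  by (simp add: root22b_def block_toeplitz_def)

lemma root22a_square:
  assumes "\<alpha>1 \<noteq> 0"
  shows "root22a \<alpha>1 \<alpha>2 \<alpha>3 \<alpha>4 * root22a \<alpha>1 \<alpha>2 \<alpha>3 \<alpha>4 = diag_block_mat [J 2, J 2]"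
proof -
  define y where "y = - \<alpha>3\<^sup>2 / \<alpha>1"
  define q where "q = 1 / \<alpha>1\<^sup>2 * (\<alpha>1 + \<alpha>3\<^sup>2 * \<alpha>2 - 2 * \<alpha>1 * \<alpha>3 * \<alpha>4)"
  have y: "\<alpha>1 * y = - \<alpha>3 * \<alpha>3" using assms by (simp add: y_def power2_eq_square)
  have "\<alpha>1 * (\<alpha>1 * q) = \<alpha>1 + \<alpha>3\<^sup>2 * \<alpha>2 - 2 * \<alpha>1 * \<alpha>3 * \<alpha>4"
    using assms by (simp add: q_def power2_eq_square)
  also have "\<dots> = \<alpha>1 * (1 - y * \<alpha>2 - 2 * \<alpha>3 * \<alpha>4)"
    using arg_cong[OF y, of "(*) \<alpha>2"] by (simp add: algebra_simps power2_eq_square)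
  finally have q: "\<alpha>1 * q = 1 - y * \<alpha>2 - 2 * \<alpha>3 * \<alpha>4" using assms by simp
  show ?thesis
    unfolding root22a_block_toeplitz y_def[symmetric] q_def[symmetric] block_toeplitz_square
    using y q by (simp add: algebra_simps)
qed

lemma root22b_square:
  assumes "\<gamma>2 \<noteq> 0"
  shows "root22b \<gamma>1 \<gamma>2 \<gamma>3 * root22b \<gamma>1 \<gamma>2 \<gamma>3 = diag_block_mat [J 2, J 2]"
  unfolding root22b_block_toeplitz block_toeplitz_square using assms by simp

text \<open>By commutation the root is \<open>X \<otimes> 1 + Y \<otimes> N\<close>. Here \<open>X\<close> is nilpotent but nonzero, so its lower
  left entry \<open>z\<close> or its upper right entry \<open>y\<close> is nonzero. The families are distinguished by whether
  \<open>z\<close> vanishes. In both of them \<open>X Y + Y X = 1\<close> makes the trace of \<open>Y\<close> zero and fixes one further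
  entry of \<open>Y\<close>.\<close>
lemma square_root_J2_J2_cases:
  assumes A: "A \<in> carrier_mat 4 4" and sq: "A * A = diag_block_mat [J 2, J 2]"
  shows "(\<exists>\<alpha>1 \<alpha>2 \<alpha>3 \<alpha>4. \<alpha>1 \<noteq> 0 \<and> A = root22a \<alpha>1 \<alpha>2 \<alpha>3 \<alpha>4)
       \<or> (\<exists>\<gamma>1 \<gamma>2 \<gamma>3. \<gamma>2 \<noteq> 0 \<and> A = root22b \<gamma>1 \<gamma>2 \<gamma>3)"
proof -
  let ?N = "mat_of_rows_list 4 [[0,1,0,0],[0,0,0,0],[0,0,0,1],[0,0,0,0]] :: complex mat"
  have N: "?N \<in> carrier_mat 4 4" by (simp add: mat_of_rows_list_carrier)
  have c: "A $$ (1,0) = 0" "A $$ (1,1) = A $$ (0,0)" "A $$ (1,2) = 0" "A $$ (1,3) = A $$ (0,2)"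
     "A $$ (3,0) = 0" "A $$ (3,1) = A $$ (2,0)" "A $$ (3,2) = 0" "A $$ (3,3) = A $$ (2,2)"
    using square_root_commutes_entries[OF A N sq[unfolded diag_J2_J2]]
    by (simp_all add: four_simps)
  define a p y q where row0: "a = A $$ (0,0)" "p = A $$ (0,1)" "y = A $$ (0,2)" "q = A $$ (0,3)"
  define z r x s where row2: "z = A $$ (2,0)" "r = A $$ (2,1)" "x = A $$ (2,2)" "s = A $$ (2,3)"
  have A_eq: "A = block_toeplitz a p y q z r x s"
    unfolding block_toeplitz_def row0 row2
    by (subst mat_eq_iff_entries[OF A]) (simp_all add: four_simps c[unfolded One_nat_def])
  \<comment> \<open>The first three equations belong to \<open>X\<^sup>2 = 0\<close>, the others to \<open>X Y + Y X = 1\<close>.\<close>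
  have e: "z * a + x * z = 0" "z * y + x * x = 0" "a * a + y * z = 0"
      "a * p + p * a + y * r + q * z = 1" "a * q + p * y + y * s + q * x = 0"
      "z * p + r * a + x * r + s * z = 0" "z * q + r * y + x * s + s * x = 1"
    using sq[unfolded A_eq block_toeplitz_square] by blast+
  show ?thesis
  proof (cases "z = 0")
    case True
    with e have 0: "a = 0" "x = 0" by simp_all
    from e(4) True 0 have yr: "y * r = 1" by simp
    then have y: "y \<noteq> 0" by auto
    with yr have r: "r = 1 / y" by (simp add: field_simps)
    have "y * (p + s) = 0" using e(5) 0 by (simp add: algebra_simps)
    with y have s: "s = - p" by (simp add: add_eq_0_iff)
    have "A = root22b p y q"
      by (simp add: A_eq root22b_def block_toeplitz_def True 0 r s)
    with y show ?thesis by blast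
  next
    case False
    have "z * (a + x) = 0" using e(1) by (simp add: algebra_simps)
    with False have a: "a = - x" by (simp add: eq_neg_iff_add_eq_0)
    have y: "y = - x\<^sup>2 / z"
      using e(2) False by (simp add: field_simps power2_eq_square eq_neg_iff_add_eq_0)
    have "z * (p + s) = 0" using e(6) a by (simp add: algebra_simps)
    with False have p: "p = - s" by (simp add: eq_neg_iff_add_eq_0)
    have "q * z = 1 - 2 * x * s - y * r" using e(7) by (simp add: algebra_simps)
    then have "q = (1 - 2 * x * s - y * r) / z" using False by (simp add: field_simps)
    also have "\<dots> = 1 / z\<^sup>2 * (z + x\<^sup>2 * r - 2 * z * x * s)"
      using False y by (simp add: divide_simps power2_eq_square) (simp add: algebra_simps)
    finally have q: "q = 1 / z\<^sup>2 * (z + x\<^sup>2 * r - 2 * z * x * s)" .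
    have "A = root22a z r x s"
      using a y p q by (simp add: A_eq root22a_def block_toeplitz_def Let_def)
    with False show ?thesis by blast
  qed
qed

lemma square_roots_J2_J2:
  "{A. square_root A (diag_block_mat [J 2, J 2])}
     = {root22a \<alpha>1 \<alpha>2 \<alpha>3 \<alpha>4 | \<alpha>1 \<alpha>2 \<alpha>3 \<alpha>4. \<alpha>1 \<noteq> 0}
       \<union> {root22b \<gamma>1 \<gamma>2 \<gamma>3 | \<gamma>1 \<gamma>2 \<gamma>3. \<gamma>2 \<noteq> 0}" (is "?L = ?R")
proof -
  have dim: "dim_row (diag_block_mat [J 2, J 2]) = 4"
    unfolding diag_J2_J2 by (simp add: mat_of_rows_list_def)
  have "root22a \<alpha>1 \<alpha>2 \<alpha>3 \<alpha>4 \<in> carrier_mat 4 4" "root22b \<gamma>1 \<gamma>2 \<gamma>3 \<in> carrier_mat 4 4"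
    for \<alpha>1 \<alpha>2 \<alpha>3 \<alpha>4 \<gamma>1 \<gamma>2 \<gamma>3
    by (simp_all add: root22a_def root22b_def Let_def mat_of_rows_list_carrier)
  then have "?R \<subseteq> ?L"
    unfolding square_root_def dim using root22a_square root22b_square by auto
  moreover have "?L \<subseteq> ?R"
    unfolding square_root_def dim using square_root_J2_J2_cases by blast
  ultimately show ?thesis by (rule subset_antisym[rotated])
qed

text \<open>The fourth power is \<open>(J 2 \<oplus> J 2)\<^sup>2 = 0\<close>. The third is \<open>X \<otimes> N\<close>, which is nonzero as soon as
  \<open>X\<close> is.\<close>
lemma jordan_nf_block_toeplitz:
  assumes sq: "block_toeplitz a p y q z r x s * block_toeplitz a p y q z r x s
                 = diag_block_mat [J 2, J 2]" (is "?A * ?A = _")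
    and nz: "y \<noteq> 0 \<or> z \<noteq> 0"
  shows "jordan_nf (block_toeplitz a p y q z r x s) [(4, 0)]"
proof (rule jordan_nf_single_block)
  let ?N = "mat_of_rows_list 4 [[0,1,0,0],[0,0,0,0],[0,0,0,1],[0,0,0,0]] :: complex mat"
  show A: "?A \<in> carrier_mat 4 4" by (simp add: block_toeplitz_def mat_of_rows_list_carrier)
  have "?N * ?N = 0\<^sub>m 4 4"
    by (subst mat_mult_eq_iff_entries[of _ 4]) (simp_all add: four_simps)
  then show "?A ^\<^sub>m 4 = 0\<^sub>m 4 4"
    by (simp only: pow_mat_small[OF A] sq diag_J2_J2)
  have "?N * ?A \<noteq> 0\<^sub>m 4 4"
    using nz unfolding block_toeplitz_def
    by (subst mat_mult_eq_iff_entries[of _ 4]) (auto simp: four_simps)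
  moreover have "?A ^\<^sub>m 3 = ?N * ?A"
    by (simp only: pow_mat_small[OF A] sq diag_J2_J2)
  ultimately show "?A ^\<^sub>m (4 - 1) \<noteq> 0\<^sub>m 4 4" by simp
qed

lemma jordan_nf_root22a:
  assumes "\<alpha>1 \<noteq> 0"
  shows "jordan_nf (root22a \<alpha>1 \<alpha>2 \<alpha>3 \<alpha>4) [(4, 0)]"
  using root22a_square[OF assms] assms unfolding root22a_block_toeplitz
  by (blast intro: jordan_nf_block_toeplitz)

lemma jordan_nf_root22b:
  assumes "\<gamma>2 \<noteq> 0"
  shows "jordan_nf (root22b \<gamma>1 \<gamma>2 \<gamma>3) [(4, 0)]"
  using root22b_square[OF assms] assms unfolding root22b_block_toeplitz
  by (blast intro: jordan_nf_block_toeplitz)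

section \<open>Segre pairs and their square roots\<close>

theorem theorem3p3:
  fixes n :: nat and H B0 :: "complex mat"
    and n_as :: "(nat \<times> complex) list" and S :: "(nat \<times> nat) multiset"
  assumes "H \<in> carrier_mat n n" and "invertible_mat H" and "hermitian_mat H"
    and "B0 \<in> carrier_mat n n" and "nilpotent_mat B0" and "H_nonnegative H B0"
    and "B0 = jordan_matrix n_as" and "0 \<notin> fst ` set n_as"
    and "segre_pairing B0 S"
  shows
    "(\<forall>p \<in> set_mset S. p \<in> {(2, 2), (2, 1), (1, 1), (1, 0)})
     \<and> image_mset (\<lambda>(k, a). jordan_block k a) (mset n_as) = (\<Sum>p\<in>#S. mset (pair_blocks p))
     \<and> pair_blocks (2, 2) = [J 2, J 2] \<and> pair_blocks (2, 1) = [J 2, J 1]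
     \<and> pair_blocks (1, 1) = [J 1, J 1] \<and> pair_blocks (1, 0) = [J 1]

     \<and> J 1 = mat_of_rows_list 1 [[0]]
     \<and> {A. square_root A (J 1)} = {mat_of_rows_list 1 [[0]]}
     \<and> jordan_nf (mat_of_rows_list 1 [[0 :: complex]]) [(1, 0)]

     \<and> {A. square_root A (diag_block_mat [J 1, J 1])}
         = {root11a \<alpha> \<beta> | \<alpha> \<beta>. \<beta> \<noteq> 0} \<union> {root11b \<alpha> | \<alpha>. True}
     \<and> (\<forall>\<alpha> \<beta>. \<beta> \<noteq> 0 \<longrightarrow> jordan_nf (root11a \<alpha> \<beta>) [(2, 0)])
     \<and> (\<forall>\<alpha>. \<alpha> \<noteq> 0 \<longrightarrow> jordan_nf (root11b \<alpha>) [(2, 0)])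
     \<and> jordan_nf (root11b 0) [(1, 0), (1, 0)]

     \<and> {A. square_root A (diag_block_mat [J 2, J 1])} = {root21 \<alpha> \<beta> | \<alpha> \<beta>. \<beta> \<noteq> 0}
     \<and> (\<forall>\<alpha> \<beta>. \<beta> \<noteq> 0 \<longrightarrow> jordan_nf (root21 \<alpha> \<beta>) [(3, 0)])

     \<and> {A. square_root A (diag_block_mat [J 2, J 2])}
         = {root22a \<alpha>1 \<alpha>2 \<alpha>3 \<alpha>4 | \<alpha>1 \<alpha>2 \<alpha>3 \<alpha>4. \<alpha>1 \<noteq> 0}
           \<union> {root22b \<gamma>1 \<gamma>2 \<gamma>3 | \<gamma>1 \<gamma>2 \<gamma>3. \<gamma>2 \<noteq> 0}
     \<and> (\<forall>\<alpha>1 \<alpha>2 \<alpha>3 \<alpha>4. \<alpha>1 \<noteq> 0 \<longrightarrow> jordan_nf (root22a \<alpha>1 \<alpha>2 \<alpha>3 \<alpha>4) [(4, 0)])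
     \<and> (\<forall>\<gamma>1 \<gamma>2 \<gamma>3. \<gamma>2 \<noteq> 0 \<longrightarrow> jordan_nf (root22b \<gamma>1 \<gamma>2 \<gamma>3) [(4, 0)])"
proof -
  have sq: "B0 ^\<^sub>m 2 = 0\<^sub>m n n"
    using assms by (intro H_nonnegative_nilpotent_square_zero)
  have nf: "jordan_nf B0 n_as"
    using assms by (auto simp: jordan_nf_def intro: similar_mat_refl)
  have J1: "J 1 = mat_of_rows_list 1 [[0]]"
    by (rule eq_matI) (auto simp: mat_of_rows_list_def)
  show ?thesis
    using segre_pairing_entries[OF sq assms(4,9)]
    by (intro conjI ballI allI impI segre_pairing_blocks[OF nf assms(9)] J1 square_roots_J1
        square_roots_J1_J1 square_roots_J2_J1 square_roots_J2_J2 jordan_nf_zero_1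
        jordan_nf_root11a jordan_nf_root11b jordan_nf_root11b_zero jordan_nf_root21
        jordan_nf_root22a jordan_nf_root22b)
      (simp_all add: pair_blocks_def)
qed

end
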